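(* Let $L_0, L_1 \ge 0$ and let $f\colon \mathbb{R}^d \to \mathbb{R}$ be three times continuously differentiable. For $x,s\in\mathbb{R}^d$ put $$\tilde L(x,s) := L_0 + L_1 \max_{t\in[0,1]} \|\nabla f(x) + t\nabla^2 f(x)s\| ,$$ and write $\alpha := \sqrt{L_1}\,\|s\|$. Then the following four statements are equivalent. (1) For all $x\in\mathbb{R}^d$, $\ \|\nabla^3 f(x)\| \le L_0 + L_1\|\nabla f(x)\|$. (2) For all $x,s\in\mathbb{R}^d$, $\ \|\nabla^2 f(x+s) - \nabla^2 f(x)\| \le \tilde L(x,s)\,\|s\|\,\dfrac{\sinh\alpha}{\alpha}$. (3) For all $x,s\in\mathbb{R}^d$, $\ \|\nabla f(x+s) - \nabla f(x) - \nabla^2 f(x)s\| \le \tilde L(x,s)\,\|s\|^2\,\dfrac{\cosh\alpha - 1}{\alpha^2}$. (4) For all $x,s\in\mathbb{R}^d$, $\ \left| f(x+s) - f(x) - \langle\nabla f(x), s\rangle - \tfrac12\langle\nabla^2 f(x)s, s\rangle\right| \le \tilde L(x,s)\,\|s\|^3\,\dfrac{\sinh\alpha-\alpha}{\alpha^3}$.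
   Context: $\langle\cdot,\cdot\rangle$ and $\|\cdot\|$ denote the Euclidean inner product and norm on $\mathbb{R}^d$; for a matrix, $\|\cdot\|$ is the operator norm (largest singular value); for a symmetric third-order tensor $T$, $\|T\| := \sup_{\|u_1\|=\|u_2\|=\|u_3\|=1}|T[u_1,u_2,u_3]| = \sup_{\|u\|=1}|T[u,u,u]|$. Quotients of hyperbolic functions with a removable singularity at $0$ are understood by continuous extension: at $\alpha=0$, $\frac{\sinh\alpha}{\alpha}=1$, $\frac{\cosh\alpha-1}{\alpha^2}=\frac12$, $\frac{\sinh\alpha-\alpha}{\alpha^3}=\frac16$. (By convexity of the norm, $\tilde L(x,s) = L_0 + L_1\max\{\|\nabla f(x)\|, \|\nabla f(x)+\nabla^2 f(x)s\|\}$.) *)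

theory Defs
  imports "HOL-Analysis.Analysis"
begin

definition gradient :: "(real ^ 'n \<Rightarrow> real) \<Rightarrow> real ^ 'n \<Rightarrow> real ^ 'n"
  where "gradient f x = (THE g. GDERIV f x :> g)"

definition hessian :: "(real ^ 'n \<Rightarrow> real) \<Rightarrow> real ^ 'n \<Rightarrow> real ^ 'n ^ 'n"
  where "hessian f x = jacobian (gradient f) (at x)"

definition third_derivative ::
    "(real ^ 'n \<Rightarrow> real) \<Rightarrow> real ^ 'n \<Rightarrow> real ^ 'n \<Rightarrow> real ^ 'n \<Rightarrow> real ^ 'n \<Rightarrow> real"
  where "third_derivative f x u v w = (frechet_derivative (hessian f) (at x) u *v v) \<bullet> w"

text \<open>Continuity of the derivatives of order at most two is implied by differentiability.
  In finite dimension, continuity of the third derivative as a tensor-valued map is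
  continuity of each of its evaluations.\<close>

definition three_times_continuously_differentiable :: "(real ^ 'n \<Rightarrow> real) \<Rightarrow> bool"
  where "three_times_continuously_differentiable f \<longleftrightarrow>
    (\<forall>x. f differentiable (at x)) \<and>
    (\<forall>x. gradient f differentiable (at x)) \<and>
    (\<forall>x. hessian f differentiable (at x)) \<and>
    (\<forall>u v w. continuous_on UNIV (\<lambda>x. third_derivative f x u v w))"

text \<open>The library's \<^const>\<open>norm\<close> on matrices is the Frobenius norm, not the operator norm.\<close>

definition matrix_norm :: "real ^ 'n ^ 'm \<Rightarrow> real"
  where "matrix_norm A = onorm ((*v) A)"

definition tensor_norm :: "(real ^ 'n \<Rightarrow> real ^ 'n \<Rightarrow> real ^ 'n \<Rightarrow> real) \<Rightarrow> real"
  where "tensor_norm T =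
    (SUP (u, v, w) \<in> sphere 0 1 \<times> sphere 0 1 \<times> sphere 0 1. \<bar>T u v w\<bar>)"

text \<open>The supremum is a maximum: a continuous function is taken over a compact interval.\<close>

definition L_tilde :: "(real ^ 'n \<Rightarrow> real) \<Rightarrow> real \<Rightarrow> real \<Rightarrow> real ^ 'n \<Rightarrow> real ^ 'n \<Rightarrow> real"
  where "L_tilde f L0 L1 x s =
    L0 + L1 * (SUP t\<in>{0..1}. norm (gradient f x + t *\<^sub>R (hessian f x *v s)))"

text \<open>The following quotients are extended continuously to \<open>0\<close>, where division in HOL
  would give \<open>0\<close>.\<close>

definition sinh_quot :: "real \<Rightarrow> real"
  where "sinh_quot a = (if a = 0 then 1 else sinh a / a)"

definition cosh_quot :: "real \<Rightarrow> real"
  where "cosh_quot a = (if a = 0 then 1 / 2 else (cosh a - 1) / a ^ 2)"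

definition sinh_cubic_quot :: "real \<Rightarrow> real"
  where "sinh_cubic_quot a = (if a = 0 then 1 / 6 else (sinh a - a) / a ^ 3)"

end

theory Submission
  imports Defs
begin

text \<open>
  All four conditions are compared along segments \<open>t \<mapsto> x + t s\<close>. Write \<open>L\<close> for \<open>L_tilde f L0 L1 x s\<close>,
  \<open>\<alpha>\<close> for \<open>sqrt L1 * norm s\<close>, and \<open>r t\<close> for the norm of the first-order Taylor remainder of the
  gradient at \<open>x + t s\<close>.

  From the bound on the third derivative to the remainder bounds: everything follows by integrating
  the growth estimate \<open>L0 + L1 * norm (gradient f (x + t s)) \<le> L * cosh (\<alpha> t)\<close> one, two or
  three times, since the three quotients, multiplied by \<open>t\<close>, \<open>t\<^sup>2\<close>, \<open>t\<^sup>3\<close>, are the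
  iterated integrals of \<open>cosh (\<alpha> t)\<close> (lemma \<open>remainder_bounds\<close>). The growth estimate itself
  is circular at first sight, as it needs a bound on \<open>r\<close>, which comes out of the integration. The
  circle closes through a maximum: let \<open>m\<close> be the maximum over \<open>[0, 1]\<close> of
  \<open>(L + L1 * r t) / cosh (\<alpha> t)\<close>. Integrating twice with \<open>m\<close> in place of \<open>L\<close> gives
  \<open>L1 * r t \<le> m * (cosh (\<alpha> t) - 1)\<close>, and at the point where the maximum is attained this reads
  \<open>m * cosh \<le> L + m * cosh - m\<close>, that is, \<open>m \<le> L\<close> (lemma \<open>gradient_growth\<close>).

  From the remainder bounds to the bound on the third derivative: divide by the appropriate power of
  \<open>h\<close> on the segment from \<open>x\<close> to \<open>x + h u\<close> with \<open>u\<close> a unit vector and let \<open>h\<close> tend to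
  \<open>0\<close> from the right. L'Hopital's rule turns the left-hand sides into \<open>T u v w\<close>, \<open>T u u w / 2\<close>
  and \<open>T u u u / 6\<close>, where \<open>T\<close> is the third derivative at \<open>x\<close>, and the right-hand sides into
  the same fractions of \<open>L0 + L1 * norm (gradient f x)\<close>. The last two limits see \<open>T\<close> on partial
  or full diagonals only. As \<open>T\<close> is symmetric (lemma \<open>derivative_of_gradient_symmetric\<close>, applied
  to \<open>f\<close> and to the components of its gradient), polarization and Banach's theorem on symmetric
  trilinear forms (lemma \<open>symmetric_trilinear_le_of_diagonal_le\<close>) recover the full norm.
\<close>

section \<open>Trilinear forms\<close>

definition trilinear :: "('a::euclidean_space \<Rightarrow> 'a \<Rightarrow> 'a \<Rightarrow> real) \<Rightarrow> bool"
  where "trilinear T \<longleftrightarrow>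
    (\<forall>v w. linear (\<lambda>u. T u v w)) \<and> (\<forall>u w. linear (\<lambda>v. T u v w)) \<and> (\<forall>u v. linear (T u v))"

lemma continuous_on_trilinear:
  assumes "trilinear T"
  shows "continuous_on A (\<lambda>(u, v, w). T u v w)"
proof -
  have lin: "linear (\<lambda>u. T u v w)" "linear (\<lambda>v. T u v w)" "linear (T u v)" for u v w
    using assms by (auto simp: trilinear_def)
  have bil: "bounded_bilinear (T b)" for b
    using lin by (simp add: bilinear_def bilinear_conv_bounded_bilinear[symmetric])
  \<comment> \<open>Expanding the first argument in the basis leaves finitely many bilinear forms, which are continuous.\<close>
  have expand: "T u v w = (\<Sum>b\<in>Basis. (u \<bullet> b) * T b v w)" for u v w
    using linear_sum[OF lin(1)[of v w], of "\<lambda>b. (u \<bullet> b) *\<^sub>R b" Basis]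
    by (simp add: euclidean_representation linear_scale[OF lin(1)])
  have "(\<lambda>(u, v, w). T u v w)
      = (\<lambda>p. \<Sum>b\<in>Basis. (fst p \<bullet> b) * T b (fst (snd p)) (snd (snd p)))"
    unfolding case_prod_beta by (rule ext) (rule expand)
  moreover have "continuous_on A (\<lambda>p. \<Sum>b\<in>Basis. (fst p \<bullet> b) * T b (fst (snd p)) (snd (snd p)))"
    by (intro continuous_intros bounded_bilinear.continuous_on[OF bil])
  ultimately show ?thesis
    by simp
qed

text \<open>The supremum that defines \<open>tensor_norm\<close> carries information only because it is taken over a
  bounded set of values, which compactness of the spheres provides.\<close>

lemma trilinear_le_tensor_norm:
  assumes "trilinear T"
  shows "\<bar>T u v w\<bar> \<le> tensor_norm T * norm u * norm v * norm w"
proof -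
  have lin: "linear (\<lambda>u. T u v w)" "linear (\<lambda>v. T u v w)" "linear (T u v)" for u v w
    using assms by (auto simp: trilinear_def)
  let ?S = "sphere 0 1 \<times> sphere 0 1 \<times> sphere 0 (1::real) :: ((real^'n) \<times> (real^'n) \<times> (real^'n)) set"
  let ?F = "\<lambda>(u, v, w). \<bar>T u v w\<bar>"
  have "continuous_on ?S ?F"
    using continuous_on_rabs[OF continuous_on_trilinear[OF assms]] by (simp add: case_prod_beta)
  moreover have "compact ?S"
    by (intro compact_Times compact_sphere)
  ultimately have bdd: "bdd_above (?F ` ?S)"
    by (intro bounded_imp_bdd_above compact_imp_bounded compact_continuous_image)
  have scale: "T (a *\<^sub>R u') (b *\<^sub>R v') (c *\<^sub>R w') = a * b * c * T u' v' w'" for a b c u' v' w'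
    by (simp add: linear_scale[OF lin(1)] linear_scale[OF lin(2)] linear_scale[OF lin(3)])
  have zero: "T 0 v w = 0" "T u 0 w = 0" "T u v 0 = 0"
    by (simp_all add: linear_0[OF lin(1)] linear_0[OF lin(2)] linear_0[OF lin(3)])
  show ?thesis
  proof (cases "u = 0 \<or> v = 0 \<or> w = 0")
    case True
    then show ?thesis using zero by auto
  next
    case False
    have "?F (u /\<^sub>R norm u, v /\<^sub>R norm v, w /\<^sub>R norm w) \<le> tensor_norm T"
      unfolding tensor_norm_def by (rule cSUP_upper[OF _ bdd]) (use False in auto)
    then show ?thesis
      using False by (simp add: scale abs_mult field_simps)
  qed
qed

lemma tensor_norm_nonneg:
  assumes "trilinear T"
  shows "0 \<le> tensor_norm T"
proof -
  let ?e = "axis undefined 1"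
  have "0 \<le> \<bar>T ?e ?e ?e\<bar>"
    by simp
  also have "\<dots> \<le> tensor_norm T"
    using trilinear_le_tensor_norm[OF assms, of ?e ?e ?e] by simp
  finally show ?thesis .
qed

lemma tensor_norm_leI:
  fixes T :: "real^'n \<Rightarrow> real^'n \<Rightarrow> real^'n \<Rightarrow> real"
  assumes "\<And>u v w. norm u = 1 \<Longrightarrow> norm v = 1 \<Longrightarrow> norm w = 1 \<Longrightarrow> \<bar>T u v w\<bar> \<le> c"
  shows "tensor_norm T \<le> c"
proof -
  have "(sphere 0 1 :: (real^'n) set) \<noteq> {}"
    by simp
  then show ?thesis
    unfolding tensor_norm_def by (intro cSUP_least) (auto intro!: assms)
qed

text \<open>The polarization identity \<open>4 B u v = B (u + v) (u + v) - B (u - v) (u - v)\<close> loses no constant here,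
  because the squared norms of \<open>u + v\<close> and \<open>u - v\<close> add up to exactly \<open>4\<close> for unit vectors.\<close>

lemma symmetric_bilinear_le_of_diagonal_le:
  fixes B :: "'a::euclidean_space \<Rightarrow> 'a \<Rightarrow> real"
  assumes lin: "\<And>v. linear (\<lambda>u. B u v)"
    and sym: "\<And>u v. B u v = B v u"
    and diag: "\<And>u. norm u = 1 \<Longrightarrow> \<bar>B u u\<bar> \<le> c"
    and "norm u = 1" "norm v = 1"
  shows "\<bar>B u v\<bar> \<le> c"
proof -
  have lin': "linear (B u)" for u
  proof -
    have "B u = (\<lambda>v. B v u)"
      by (rule ext) (rule sym)
    then show ?thesis
      using lin[of u] by simp
  qed
  have diag': "\<bar>B z z\<bar> \<le> c * (z \<bullet> z)" for z
  proof (cases "z = 0")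
    case True
    then show ?thesis using linear_0[OF lin] by simp
  next
    case False
    have "B (z /\<^sub>R norm z) (z /\<^sub>R norm z) = B z z / (z \<bullet> z)"
      by (simp add: linear_scale[OF lin] linear_scale[OF lin'] divide_simps
          flip: power2_norm_eq_inner power2_eq_square)
    then have "\<bar>B z z\<bar> / (z \<bullet> z) \<le> c"
      using diag[of "z /\<^sub>R norm z"] False by simp
    then show ?thesis
      using False by (simp add: field_simps)
  qed
  have "4 * B u v = B (u + v) (u + v) - B (u - v) (u - v)"
    by (simp add: linear_add[OF lin] linear_add[OF lin'] linear_diff[OF lin] linear_diff[OF lin']
        sym[of v u])
  moreover have "(u + v) \<bullet> (u + v) + (u - v) \<bullet> (u - v) = 4"
    using assms(4,5) by (simp add: norm_eq_1 inner_add inner_diff)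
  then have "c * ((u + v) \<bullet> (u + v)) + c * ((u - v) \<bullet> (u - v)) = c * 4"
    by (simp only: distrib_left[symmetric])
  ultimately show ?thesis
    using diag'[of "u + v"] diag'[of "u - v"] by linarith
qed

text \<open>Banach's theorem for trilinear forms. By bilinear polarization it suffices to bound \<open>T u u w\<close>.
  Among the pairs of unit vectors that maximize \<open>\<bar>T u u w\<bar>\<close>, take a pair \<open>(a, b)\<close> with the smallest
  angle. Polarizing in the pair \<open>a, b\<close> while the other \<open>a\<close> stays fixed shows that the normalized
  bisector \<open>z\<close> of \<open>a\<close> and \<open>b\<close> yields another maximizing pair \<open>(z, a)\<close>, at half the angle. Hence
  the angle is \<open>0\<close>, and the maximum is attained on the diagonal.\<close>

lemma symmetric_trilinear_le_of_diagonal_le: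
  fixes T :: "'a::euclidean_space \<Rightarrow> 'a \<Rightarrow> 'a \<Rightarrow> real"
  assumes tri: "trilinear T"
    and sym12: "\<And>u v w. T u v w = T v u w"
    and sym23: "\<And>u v w. T u v w = T u w v"
    and diag: "\<And>u. norm u = 1 \<Longrightarrow> \<bar>T u u u\<bar> \<le> c"
    and unit: "norm u = 1" "norm v = 1" "norm w = 1"
  shows "\<bar>T u v w\<bar> \<le> c"
proof -
  have lin: "linear (\<lambda>u. T u v w)" "linear (\<lambda>v. T u v w)" "linear (T u v)" for u v w
    using tri by (auto simp: trilinear_def)
  note add = linear_add[OF lin(1)] linear_add[OF lin(2)] linear_add[OF lin(3)]
  note scale = linear_scale[OF lin(1)] linear_scale[OF lin(2)] linear_scale[OF lin(3)]
  note minus = linear_neg[OF lin(1)] linear_neg[OF lin(2)] linear_neg[OF lin(3)]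
  note diff = linear_diff[OF lin(1)] linear_diff[OF lin(2)] linear_diff[OF lin(3)]
  define K where "K = sphere (0::'a) 1 \<times> sphere (0::'a) 1"
  define \<phi> where "\<phi> p = \<bar>T (fst p) (fst p) (snd p)\<bar>" for p
  have "continuous_on K ((\<lambda>(u, v, w). T u v w) \<circ> (\<lambda>p. (fst p, fst p, snd p)))"
    by (intro continuous_on_compose continuous_on_trilinear tri continuous_intros)
  then have cont: "continuous_on K \<phi>"
    unfolding \<phi>_def by (intro continuous_on_rabs) (simp add: o_def case_prod_beta)
  have "compact K"
    unfolding K_def by (intro compact_Times compact_sphere)
  have "(u, w) \<in> K"
    using unit by (simp add: K_def)
  then obtain q where q: "q \<in> K" "\<And>p. p \<in> K \<Longrightarrow> \<phi> p \<le> \<phi> q"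
    using continuous_attains_sup[OF \<open>compact K\<close> _ cont] by blast
  define K' where "K' = {p \<in> K. \<phi> p = \<phi> q}"
  have "compact K'"
  proof -
    have "closed K'"
      unfolding K'_def using continuous_closed_preimage_constant[OF cont] \<open>compact K\<close>
      by (simp add: compact_imp_closed)
    moreover have "K \<inter> K' = K'"
      by (auto simp: K'_def)
    ultimately show ?thesis
      using compact_Int_closed[OF \<open>compact K\<close>, of K'] by simp
  qed
  moreover have "q \<in> K'"
    using q by (simp add: K'_def)
  moreover have "continuous_on K' (\<lambda>p. fst p \<bullet> snd p)"
    by (intro continuous_intros)
  ultimately obtain p where p: "p \<in> K'" "\<And>p'. p' \<in> K' \<Longrightarrow> fst p' \<bullet> snd p' \<le> fst p \<bullet> snd p"
    using continuous_attains_sup[of K' "\<lambda>p. fst p \<bullet> snd p"] by blast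
  obtain a b where ab: "p = (a, b)" by (cases p)
  have norms: "norm a = 1" "norm b = 1" and max: "\<bar>T a a b\<bar> = \<phi> q"
    using p(1) by (auto simp: ab K'_def K_def \<phi>_def)
  have inners: "a \<bullet> a = 1" "b \<bullet> b = 1"
    using norms by (simp_all add: norm_eq_1)
  define \<gamma> where "\<gamma> = a \<bullet> b"
  have closest: "a' \<bullet> b' \<le> \<gamma>" if "norm a' = 1" "norm b' = 1" "\<phi> q \<le> \<bar>T a' a' b'\<bar>" for a' b'
    using p(2)[of "(a', b')"] q(2)[of "(a', b')"] that by (simp add: ab \<gamma>_def K'_def K_def \<phi>_def)
  \<comment> \<open>Otherwise the pair \<open>(a, - b)\<close> would also be maximizing and have a larger inner product.\<close>
  have "\<gamma> \<ge> 0"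
    using closest[of a "- b"] norms max by (simp add: minus \<gamma>_def)
  have bound: "\<bar>T z z a\<bar> \<le> \<phi> q * (z \<bullet> z)" for z
  proof (cases "z = 0")
    case True
    then show ?thesis using linear_0[OF lin(1)] by simp
  next
    case False
    have "T (z /\<^sub>R norm z) (z /\<^sub>R norm z) a = T z z a / (z \<bullet> z)"
      by (simp add: scale divide_simps flip: power2_norm_eq_inner power2_eq_square)
    moreover have "\<phi> (z /\<^sub>R norm z, a) \<le> \<phi> q"
      using q(2)[of "(z /\<^sub>R norm z, a)"] False norms by (simp add: K_def)
    ultimately have "\<bar>T z z a\<bar> / (z \<bullet> z) \<le> \<phi> q"
      by (simp add: \<phi>_def)
    then show ?thesis
      using False by (simp add: field_simps)
  qed
  define z where "z = a + b"
  have zz: "z \<bullet> z = 2 + 2 * \<gamma>"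
    using inners by (simp add: z_def \<gamma>_def inner_add inner_commute)
  \<comment> \<open>Both terms on the right are at most \<open>\<phi> q\<close> times a squared norm, and these add up to \<open>4\<close>, so the
    maximal left-hand side forces equality in the first term.\<close>
  have "4 * T a a b = T z z a - T (a - b) (a - b) a"
    unfolding z_def by (simp add: add diff sym23[of a b a] sym12[of b a a])
  moreover have "(a - b) \<bullet> (a - b) = 2 - 2 * \<gamma>"
    using inners by (simp add: \<gamma>_def inner_diff inner_commute)
  ultimately have "4 * \<phi> q \<le> \<bar>T z z a\<bar> + \<phi> q * (2 - 2 * \<gamma>)"
    using bound[of "a - b"] max by (simp add: abs_if split: if_splits)
  then have Tz: "\<phi> q * (z \<bullet> z) \<le> \<bar>T z z a\<bar>"
    by (simp add: zz algebra_simps)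
  have "z \<noteq> 0"
    using zz \<open>\<gamma> \<ge> 0\<close> by auto
  have "T (z /\<^sub>R norm z) (z /\<^sub>R norm z) a = T z z a / (z \<bullet> z)"
    by (simp add: scale divide_simps flip: power2_norm_eq_inner power2_eq_square)
  moreover have "\<phi> q \<le> \<bar>T z z a\<bar> / (z \<bullet> z)"
    using Tz \<open>z \<noteq> 0\<close> by (simp add: field_simps)
  ultimately have "\<phi> q \<le> \<bar>T (z /\<^sub>R norm z) (z /\<^sub>R norm z) a\<bar>"
    by simp
  then have "(z /\<^sub>R norm z) \<bullet> a \<le> \<gamma>"
    using \<open>z \<noteq> 0\<close> norms by (intro closest) auto
  moreover have "z \<bullet> a = 1 + \<gamma>"
    using inners by (simp add: z_def \<gamma>_def inner_add inner_commute)
  ultimately have "1 + \<gamma> \<le> \<gamma> * norm z"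
    using \<open>z \<noteq> 0\<close> by (simp add: field_simps)
  \<comment> \<open>With \<open>\<gamma> = cos \<beta>\<close>, this says \<open>cos (\<beta> / 2) \<le> cos \<beta>\<close> for an angle \<open>\<beta>\<close> between \<open>0\<close> and \<open>\<pi> / 2\<close>.\<close>
  then have "(1 + \<gamma>)\<^sup>2 \<le> (\<gamma> * norm z)\<^sup>2"
    using \<open>\<gamma> \<ge> 0\<close> by (intro power_mono) auto
  also have "\<dots> = \<gamma>\<^sup>2 * (2 + 2 * \<gamma>)"
    by (simp only: power_mult_distrib power2_norm_eq_inner zz)
  finally have "(1 + \<gamma>) * (1 + \<gamma>) \<le> (1 + \<gamma>) * (2 * \<gamma>\<^sup>2)"
    by (simp add: power2_eq_square algebra_simps)
  then have "1 + \<gamma> \<le> 2 * \<gamma>\<^sup>2"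
    using \<open>\<gamma> \<ge> 0\<close> by (simp only: mult_le_cancel_left_pos)
  then have "0 \<le> (\<gamma> - 1) * (1 + 2 * \<gamma>)"
    by (simp add: power2_eq_square algebra_simps)
  then have "\<gamma> \<ge> 1"
    using \<open>\<gamma> \<ge> 0\<close> by (simp add: zero_le_mult_iff)
  then have "(a - b) \<bullet> (a - b) \<le> 0"
    using inners by (simp add: \<gamma>_def inner_diff inner_commute)
  then have "a = b"
    using inner_ge_zero[of "a - b"] inner_eq_zero_iff[of "a - b"] by force
  then have "\<phi> q \<le> c"
    using diag[of a] norms max by simp
  have "\<bar>T x x w\<bar> \<le> c" if "norm x = 1" for x
    using q(2)[of "(x, w)"] \<open>\<phi> q \<le> c\<close> that unit by (simp add: \<phi>_def K_def)
  then show ?thesis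
    using symmetric_bilinear_le_of_diagonal_le[where B = "\<lambda>u v. T u v w", OF lin(1) sym12] unit
    by blast
qed

section \<open>Differential calculus\<close>

lemma has_vector_derivative_along_line:
  assumes "(G has_derivative G') (at (x + t *\<^sub>R s))"
  shows "((\<lambda>t. G (x + t *\<^sub>R s)) has_vector_derivative G' s) (at t)"
proof -
  have "((\<lambda>t. x + t *\<^sub>R s) has_derivative (\<lambda>h. h *\<^sub>R s)) (at t)"
    by (auto intro!: derivative_eq_intros)
  from has_derivative_compose[OF this, of G G'] assms show ?thesis
    by (simp add: has_vector_derivative_def linear_scale[OF has_derivative_linear[OF assms]])
qed

text \<open>This replaces every integration in the argument: the integral of a bound on
  \<open>norm (y' t)\<close> enters as an antiderivative \<open>\<phi>\<close> that is known explicitly.\<close>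

lemma norm_le_of_derivative_le:
  fixes y :: "real \<Rightarrow> 'a::real_normed_vector"
  assumes "0 \<le> t"
    and y: "\<And>\<tau>. (y has_vector_derivative y' \<tau>) (at \<tau>)"
    and \<phi>: "\<And>\<tau>. (\<phi> has_real_derivative \<phi>' \<tau>) (at \<tau>)"
    and le: "\<And>\<tau>. 0 \<le> \<tau> \<Longrightarrow> \<tau> \<le> t \<Longrightarrow> norm (y' \<tau>) \<le> \<phi>' \<tau>"
    and "y 0 = 0" "\<phi> 0 = 0"
  shows "norm (y t) \<le> \<phi> t"
proof (cases "t = 0")
  case True
  then show ?thesis using assms by simp
next
  case False
  have "norm (y t - y 0) \<le> \<phi> t - \<phi> 0"
  proof (rule differentiable_bound_general)
    show "0 < t"
      using False \<open>0 \<le> t\<close> by simp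
    show "continuous_on {0..t} y"
      using y by (blast intro: continuous_at_imp_continuous_on has_vector_derivative_continuous)
    show "continuous_on {0..t} \<phi>"
      using \<phi> by (blast intro: continuous_at_imp_continuous_on DERIV_isCont)
    show "(\<phi> has_vector_derivative \<phi>' \<tau>) (at \<tau>)" for \<tau>
      using \<phi> by (simp add: has_real_derivative_iff_has_vector_derivative)
  qed (use y le in auto)
  then show ?thesis
    using assms by simp
qed

text \<open>L'Hopital's rule against powers; iterating it finds the leading coefficient of a Taylor remainder
  from that of its derivative.\<close>

lemma tendsto_div_power_Suc:
  fixes \<phi> \<psi> :: "real \<Rightarrow> real"
  assumes deriv: "\<And>t. (\<phi> has_real_derivative \<psi> t) (at t)"
    and "\<phi> 0 = 0"
    and lim: "((\<lambda>h. \<psi> h / h ^ k) \<longlongrightarrow> l) (at_right 0)"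
  shows "((\<lambda>h. \<phi> h / h ^ Suc k) \<longlongrightarrow> l / Suc k) (at_right 0)"
proof (rule lhopital_right_0[where f' = \<psi> and g' = "\<lambda>h. Suc k * h ^ k"])
  have "isCont \<phi> 0"
    using deriv DERIV_isCont by blast
  then show "(\<phi> \<longlongrightarrow> 0) (at_right 0)"
    using \<open>\<phi> 0 = 0\<close> by (simp add: isCont_def filterlim_at_split)
  have "((\<lambda>h::real. h ^ Suc k) \<longlongrightarrow> 0 ^ Suc k) (at_right 0)"
    by (intro tendsto_intros)
  then show "((\<lambda>h::real. h ^ Suc k) \<longlongrightarrow> 0) (at_right 0)"
    by simp
  show "\<forall>\<^sub>F h in at_right (0::real). h ^ Suc k \<noteq> 0"
    by (rule eventually_mono[OF eventually_at_right_less]) simp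
  show "\<forall>\<^sub>F h in at_right (0::real). real (Suc k) * h ^ k \<noteq> 0"
    by (rule eventually_mono[OF eventually_at_right_less]) simp
  show "\<forall>\<^sub>F h in at_right 0. (\<phi> has_real_derivative \<psi> h) (at h)"
    using deriv by simp
  show "\<forall>\<^sub>F h in at_right 0. ((\<lambda>h. h ^ Suc k) has_real_derivative real (Suc k) * h ^ k) (at h)"
    using DERIV_pow[of "Suc k"] by simp
  have "((\<lambda>h. \<psi> h / h ^ k / Suc k) \<longlongrightarrow> l / Suc k) (at_right 0)"
    by (intro tendsto_divide lim tendsto_const) simp
  then show "((\<lambda>h. \<psi> h / (real (Suc k) * h ^ k)) \<longlongrightarrow> l / Suc k) (at_right 0)"
    by (simp only: divide_divide_eq_left mult.commute)
qed

text \<open>The symmetry of second derivatives at a point, in gradient form. The second difference \<open>\<Delta> u v h\<close>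
  is symmetric in \<open>u\<close> and \<open>v\<close> by its definition. The mean value theorem in the direction \<open>v\<close>
  writes it as a difference of two gradients at distance of order \<open>h\<close> from \<open>x\<close>, and the linear
  approximation of \<open>G\<close> at \<open>x\<close> then gives the limit \<open>A u \<bullet> v\<close> of \<open>\<Delta> u v h / h\<^sup>2\<close>.\<close>

lemma derivative_of_gradient_symmetric:
  fixes \<phi> :: "'a::real_inner \<Rightarrow> real"
  assumes G: "\<And>y. (\<phi> has_derivative (\<lambda>h. h \<bullet> G y)) (at y)"
    and A: "(G has_derivative A) (at x)"
  shows "A u \<bullet> v = A v \<bullet> u"
proof -
  interpret A: bounded_linear A
    using A by (rule has_derivative_bounded_linear)
  define \<Delta> where "\<Delta> u v h = \<phi> (x + h *\<^sub>R u + h *\<^sub>R v) - \<phi> (x + h *\<^sub>R u) - \<phi> (x + h *\<^sub>R v) + \<phi> x"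
    for u v h
  have lim: "((\<lambda>h. \<Delta> u v h / h\<^sup>2) \<longlongrightarrow> A u \<bullet> v) (at_right 0)" for u v
  proof (rule tendstoI)
    fix e :: real
    assume "e > 0"
    \<comment> \<open>The error of the linear approximation will enter with the factor \<open>N - 1\<close>; the additional \<open>1\<close> keeps
      \<open>N\<close> positive when \<open>v = 0\<close>.\<close>
    define N where "N = (norm u + 2 * norm v) * norm v + 1"
    have "N > 0"
      by (simp add: N_def add_nonneg_pos)
    define \<kappa> where "\<kappa> = e / (2 * N)"
    have "\<kappa> > 0"
      using \<open>e > 0\<close> \<open>N > 0\<close> by (simp add: \<kappa>_def)
    obtain d where "d > 0"
      and d: "\<And>y. norm (y - x) < d \<Longrightarrow> norm (G y - G x - A (y - x)) \<le> \<kappa> * norm (y - x)"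
      using A \<open>\<kappa> > 0\<close> unfolding has_derivative_at_alt by blast
    have close: "\<bar>\<Delta> u v h / h\<^sup>2 - A u \<bullet> v\<bar> < e" if "0 < h" and h: "h * (norm u + norm v) < d" for h
    proof -
      define k where "k t = \<phi> (x + h *\<^sub>R u + t *\<^sub>R v) - \<phi> (x + t *\<^sub>R v)" for t
      have k': "(k has_real_derivative
          v \<bullet> (G (x + h *\<^sub>R u + t *\<^sub>R v) - G (x + t *\<^sub>R v))) (at t)" for t
        unfolding k_def has_real_derivative_iff_has_vector_derivative inner_diff_right
        by (intro has_vector_derivative_diff has_vector_derivative_along_line G)
      obtain t where t: "0 < t" "t < h"
        and "k h - k 0 = (h - 0) * (v \<bullet> (G (x + h *\<^sub>R u + t *\<^sub>R v) - G (x + t *\<^sub>R v)))"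
        using MVT2[OF \<open>0 < h\<close>, of k "\<lambda>t. v \<bullet> (G (x + h *\<^sub>R u + t *\<^sub>R v) - G (x + t *\<^sub>R v))"] k' by blast
      moreover have "k h - k 0 = \<Delta> u v h"
        by (simp add: k_def \<Delta>_def)
      ultimately have \<Delta>: "\<Delta> u v h = h * (v \<bullet> (G (x + h *\<^sub>R u + t *\<^sub>R v) - G (x + t *\<^sub>R v)))"
        by simp
      define R where "R y = G y - G x - A (y - x)" for y
      have len: "norm (h *\<^sub>R u + t *\<^sub>R v) \<le> h * (norm u + norm v)" "norm (t *\<^sub>R v) \<le> h * norm v"
        using t by (auto intro!: norm_triangle_le add_mono mult_right_mono simp: distrib_left)
      moreover have "h * norm v \<le> h * (norm u + norm v)"
        using \<open>0 < h\<close> by simp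
      ultimately have "norm (R (x + h *\<^sub>R u + t *\<^sub>R v)) \<le> \<kappa> * norm (h *\<^sub>R u + t *\<^sub>R v)"
        "norm (R (x + t *\<^sub>R v)) \<le> \<kappa> * norm (t *\<^sub>R v)"
        using d[of "x + h *\<^sub>R u + t *\<^sub>R v"] d[of "x + t *\<^sub>R v"] h
        by (auto simp: R_def add.assoc)
      moreover have "\<kappa> * norm (h *\<^sub>R u + t *\<^sub>R v) \<le> \<kappa> * (h * (norm u + norm v))"
        "\<kappa> * norm (t *\<^sub>R v) \<le> \<kappa> * (h * norm v)"
        using len \<open>\<kappa> > 0\<close> by (auto intro!: mult_left_mono simp del: norm_scaleR)
      ultimately have "norm (R (x + h *\<^sub>R u + t *\<^sub>R v) - R (x + t *\<^sub>R v))
          \<le> \<kappa> * (h * (norm u + norm v)) + \<kappa> * (h * norm v)"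
        using norm_triangle_ineq4[of "R (x + h *\<^sub>R u + t *\<^sub>R v)" "R (x + t *\<^sub>R v)"] by linarith
      also have "\<dots> = \<kappa> * h * (norm u + 2 * norm v)"
        by (simp add: algebra_simps)
      finally have R: "norm (R (x + h *\<^sub>R u + t *\<^sub>R v) - R (x + t *\<^sub>R v))
          \<le> \<kappa> * h * (norm u + 2 * norm v)" .
      have "G (x + h *\<^sub>R u + t *\<^sub>R v) - G (x + t *\<^sub>R v)
          = h *\<^sub>R A u + (R (x + h *\<^sub>R u + t *\<^sub>R v) - R (x + t *\<^sub>R v))"
        by (simp add: R_def A.add A.scaleR add.assoc)
      then have "\<Delta> u v h = h\<^sup>2 * (A u \<bullet> v)
          + h * (v \<bullet> (R (x + h *\<^sub>R u + t *\<^sub>R v) - R (x + t *\<^sub>R v)))"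
        by (simp add: \<Delta> inner_add_right power2_eq_square distrib_left inner_commute)
      then have "\<Delta> u v h / h\<^sup>2 - A u \<bullet> v
          = (v \<bullet> (R (x + h *\<^sub>R u + t *\<^sub>R v) - R (x + t *\<^sub>R v))) / h"
        using \<open>0 < h\<close> by (simp add: power2_eq_square add_divide_distrib)
      also have "\<bar>\<dots>\<bar> \<le> norm v * (\<kappa> * h * (norm u + 2 * norm v)) / h"
      proof -
        have "\<bar>v \<bullet> (R (x + h *\<^sub>R u + t *\<^sub>R v) - R (x + t *\<^sub>R v))\<bar>
            \<le> norm v * (\<kappa> * h * (norm u + 2 * norm v))"
          by (rule order_trans[OF Cauchy_Schwarz_ineq2 mult_left_mono[OF R norm_ge_zero]])
        then show ?thesis
          using \<open>0 < h\<close> by (simp only: abs_divide abs_of_pos divide_right_mono less_imp_le)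
      qed
      also have "\<dots> = \<kappa> * (N - 1)"
        using \<open>0 < h\<close> by (simp add: N_def)
      also have "\<dots> < e"
        using \<open>e > 0\<close> \<open>N > 0\<close> by (simp add: \<kappa>_def field_simps add_pos_pos)
      finally show ?thesis .
    qed
    have "((\<lambda>h. h * (norm u + norm v)) \<longlongrightarrow> 0 * (norm u + norm v)) (at_right 0)"
      by (intro tendsto_intros)
    then have "\<forall>\<^sub>F h in at_right 0. h * (norm u + norm v) < d"
      using \<open>d > 0\<close> by (intro order_tendstoD(2)[of _ "0 * (norm u + norm v)"]) auto
    then show "\<forall>\<^sub>F h in at_right 0. dist (\<Delta> u v h / h\<^sup>2) (A u \<bullet> v) < e"
      using eventually_at_right_less[of "0::real"] by eventually_elim (simp add: dist_real_def close)
  qed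
  moreover have "\<Delta> v u h = \<Delta> u v h" for h
    by (simp add: \<Delta>_def algebra_simps)
  ultimately show ?thesis
    using tendsto_unique[OF trivial_limit_at_right_real lim[of u v]] lim[of v u] by simp
qed

section \<open>The comparison functions\<close>

text \<open>The functions \<open>t * sinh_quot (a t)\<close>, \<open>t\<^sup>2 * cosh_quot (a t)\<close> and \<open>t\<^sup>3 * sinh_cubic_quot (a t)\<close>
  form a chain of antiderivatives starting from \<open>cosh (a t)\<close>, all of them vanishing at \<open>0\<close>. Writing
  the bounds with these products covers the degenerate case \<open>a = 0\<close>, where they are \<open>t\<close>,
  \<open>t\<^sup>2 / 2\<close> and \<open>t\<^sup>3 / 6\<close>.\<close>

lemma has_derivative_sinh_quot:
  "((\<lambda>t. t * sinh_quot (a * t)) has_real_derivative cosh (a * t)) (at t)"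
proof (cases "a = 0")
  case False
  then have "(\<lambda>t. t * sinh_quot (a * t)) = (\<lambda>t. sinh (a * t) / a)"
    by (auto simp: sinh_quot_def)
  with False show ?thesis
    by (auto intro!: derivative_eq_intros)
qed (simp add: sinh_quot_def)

lemma has_derivative_cosh_quot:
  "((\<lambda>t. t\<^sup>2 * cosh_quot (a * t)) has_real_derivative t * sinh_quot (a * t)) (at t)"
proof (cases "a = 0")
  case True
  then show ?thesis
    by (auto simp: cosh_quot_def sinh_quot_def intro!: derivative_eq_intros)
next
  case False
  then have "(\<lambda>t. t\<^sup>2 * cosh_quot (a * t)) = (\<lambda>t. (cosh (a * t) - 1) / a\<^sup>2)"
    by (auto simp: cosh_quot_def field_simps)
  moreover have "t * sinh_quot (a * t) = sinh (a * t) / a"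
    using False by (auto simp: sinh_quot_def)
  ultimately show ?thesis
    using False by (auto intro!: derivative_eq_intros simp: power2_eq_square)
qed

lemma has_derivative_sinh_cubic_quot:
  "((\<lambda>t. t ^ 3 * sinh_cubic_quot (a * t)) has_real_derivative t\<^sup>2 * cosh_quot (a * t)) (at t)"
proof (cases "a = 0")
  case True
  then show ?thesis
    by (auto simp: cosh_quot_def sinh_cubic_quot_def intro!: derivative_eq_intros)
next
  case False
  then have "(\<lambda>t. t ^ 3 * sinh_cubic_quot (a * t)) = (\<lambda>t. (sinh (a * t) - a * t) / a ^ 3)"
    by (auto simp: sinh_cubic_quot_def field_simps)
  moreover have "t\<^sup>2 * cosh_quot (a * t) = (cosh (a * t) * a - a) / a ^ 3"
    using False by (auto simp: cosh_quot_def power3_eq_cube power2_eq_square field_simps)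
  moreover have "((\<lambda>t. (sinh (a * t) - a * t) / a ^ 3)
      has_real_derivative (cosh (a * t) * a - a) / a ^ 3) (at t)"
    by (intro DERIV_cdivide) (auto intro!: derivative_eq_intros)
  ultimately show ?thesis
    by simp
qed

lemma cosh_eq_cosh_quot: "cosh a = 1 + a\<^sup>2 * cosh_quot a"
  by (simp add: cosh_quot_def)

lemma tendsto_sinh_quot: "((\<lambda>h. h * sinh_quot (a * h) / h) \<longlongrightarrow> 1) (at_right 0)"
proof -
  have "((\<lambda>h. cosh (a * h)) \<longlongrightarrow> cosh (a * 0)) (at_right 0)"
    by (intro tendsto_intros)
  then show ?thesis
    using tendsto_div_power_Suc[OF has_derivative_sinh_quot[of a], where k = 0] by simp
qed

lemma tendsto_cosh_quot: "((\<lambda>h. h\<^sup>2 * cosh_quot (a * h) / h\<^sup>2) \<longlongrightarrow> 1 / 2) (at_right 0)"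
  using tendsto_div_power_Suc[OF has_derivative_cosh_quot[of a], where k = 1] tendsto_sinh_quot[of a]
  by (simp add: numeral_2_eq_2)

lemma tendsto_sinh_cubic_quot: "((\<lambda>h. h ^ 3 * sinh_cubic_quot (a * h) / h ^ 3) \<longlongrightarrow> 1 / 6) (at_right 0)"
  using tendsto_div_power_Suc[OF has_derivative_sinh_cubic_quot[of a] _ tendsto_cosh_quot[of a]]
  by (simp add: numeral_3_eq_3 numeral_2_eq_2)

section \<open>Gradient, Hessian and third derivative\<close>

text \<open>A linear functional is the inner product with its adjoint applied to \<open>1\<close>, which supplies the vector
  that the definite description in \<open>gradient\<close> selects.\<close>

lemma has_derivative_gradient:
  assumes "f differentiable (at x)"
  shows "(f has_derivative (\<lambda>h. h \<bullet> gradient f x)) (at x)"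
proof -
  obtain f' where f': "(f has_derivative f') (at x)"
    using assms by (auto simp: differentiable_def)
  have "f' = (\<lambda>h. h \<bullet> adjoint f' 1)"
    using adjoint_works[OF has_derivative_linear[OF f'], of _ 1] by auto
  then have gderiv: "GDERIV f x :> adjoint f' 1"
    unfolding gderiv_def using f' by (rule subst[where P = "\<lambda>g. (f has_derivative g) (at x)"])
  moreover have "g = adjoint f' 1" if "GDERIV f x :> g" for g
    using has_derivative_unique[OF that[unfolded gderiv_def] gderiv[unfolded gderiv_def]]
    by (metis inner_commute vector_eq_ldot)
  ultimately have "GDERIV f x :> gradient f x"
    unfolding gradient_def by (rule theI[where P = "\<lambda>g. GDERIV f x :> g"])
  then show ?thesis
    by (simp add: gderiv_def)
qed

lemma bounded_linear_matrix_vector_mult_left: "bounded_linear (\<lambda>A :: real^'n^'m. A *v v)"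
proof -
  have "linear (\<lambda>A :: real^'n^'m. A *v v)"
    by (rule linearI) (simp_all add: matrix_vector_mult_add_rdistrib scaleR_matrix_vector_assoc)
  then show ?thesis
    by (simp add: linear_conv_bounded_linear)
qed

lemma bounded_linear_inner_matrix_vector_mult:
  "bounded_linear (\<lambda>A :: real^'n^'m. (A *v v) \<bullet> w)"
  using bounded_linear_compose[OF bounded_linear_inner_left bounded_linear_matrix_vector_mult_left] .

lemma norm_matrix_vector_mult_le: "norm (A *v v) \<le> matrix_norm A * norm v"
  unfolding matrix_norm_def by (rule onorm) simp

lemma matrix_norm_leI:
  assumes "\<And>v. norm (A *v v) \<le> c * norm v"
  shows "matrix_norm A \<le> c"
  unfolding matrix_norm_def using assms by (rule onorm_le)

section \<open>The majorant along a segment\<close>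

lemma segment_le_L_tilde:
  fixes f :: "real ^ 'n \<Rightarrow> real"
  assumes "0 \<le> L1" "0 \<le> t" "t \<le> 1"
  shows "L0 + L1 * norm (gradient f x + t *\<^sub>R (hessian f x *v s)) \<le> L_tilde f L0 L1 x s"
proof -
  let ?N = "\<lambda>t. norm (gradient f x + t *\<^sub>R (hessian f x *v s))"
  have "compact (?N ` {0..1})"
    by (intro compact_continuous_image continuous_intros) simp
  then have "?N t \<le> (SUP t\<in>{0..1}. ?N t)"
    using assms by (intro cSUP_upper bounded_imp_bdd_above compact_imp_bounded) auto
  then show ?thesis
    using assms by (simp add: L_tilde_def mult_left_mono)
qed

lemma L_tilde_le:
  fixes f :: "real ^ 'n \<Rightarrow> real"
  assumes "0 \<le> L1"
  shows "L_tilde f L0 L1 x s \<le> L0 + L1 * (norm (gradient f x) + norm (hessian f x *v s))"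
proof -
  have "norm (gradient f x + t *\<^sub>R (hessian f x *v s))
      \<le> norm (gradient f x) + norm (hessian f x *v s)" if "t \<in> {0..1}" for t
  proof -
    have "norm (t *\<^sub>R (hessian f x *v s)) \<le> norm (hessian f x *v s)"
      using that mult_right_mono[of t 1 "norm (hessian f x *v s)"] by simp
    then show ?thesis
      using norm_triangle_ineq[of "gradient f x" "t *\<^sub>R (hessian f x *v s)"] by linarith
  qed
  then have "(SUP t\<in>{0..1}. norm (gradient f x + t *\<^sub>R (hessian f x *v s)))
      \<le> norm (gradient f x) + norm (hessian f x *v s)"
    by (intro cSUP_least) auto
  then show ?thesis
    using assms by (simp add: L_tilde_def mult_left_mono)
qed

text \<open>On a shrinking segment the majorant is squeezed between its value at \<open>t = 0\<close> and the triangle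
  inequality.\<close>

lemma L_tilde_tendsto:
  fixes f :: "real ^ 'n \<Rightarrow> real"
  assumes "0 \<le> L1"
  shows "((\<lambda>h. L_tilde f L0 L1 x (h *\<^sub>R u)) \<longlongrightarrow> L0 + L1 * norm (gradient f x)) (at_right 0)"
proof (rule tendsto_sandwich)
  show "\<forall>\<^sub>F h in at_right 0. L0 + L1 * norm (gradient f x) \<le> L_tilde f L0 L1 x (h *\<^sub>R u)"
    using segment_le_L_tilde[OF assms, of 0 L0 f x] by simp
  show "\<forall>\<^sub>F h in at_right 0. L_tilde f L0 L1 x (h *\<^sub>R u)
      \<le> L0 + L1 * (norm (gradient f x) + \<bar>h\<bar> * norm (hessian f x *v u))"
    using L_tilde_le[OF assms, of f L0 x "_ *\<^sub>R u"] by (simp add: matrix_vector_mult_scaleR)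
  have "((\<lambda>h. L0 + L1 * (norm (gradient f x) + \<bar>h\<bar> * norm (hessian f x *v u))) \<longlongrightarrow>
      L0 + L1 * (norm (gradient f x) + \<bar>0\<bar> * norm (hessian f x *v u))) (at_right 0)"
    by (intro tendsto_intros)
  then show "((\<lambda>h. L0 + L1 * (norm (gradient f x) + \<bar>h\<bar> * norm (hessian f x *v u))) \<longlongrightarrow>
      L0 + L1 * norm (gradient f x)) (at_right 0)"
    by simp
qed (rule tendsto_const)

text \<open>The limit argument shared by the three converse implications: \<open>\<rho>\<close> is a remainder along the ray from
  \<open>x\<close> in the direction \<open>u\<close>, \<open>\<Phi>\<close> is its hyperbolic bound, and both have order \<open>k\<close> at \<open>0\<close>. The
  Taylor coefficient \<open>q\<close> is common to both sides and cancels.\<close>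

lemma abs_le_of_remainder_limits:
  fixes f :: "real ^ 'n \<Rightarrow> real"
  assumes "0 \<le> L1" "0 < q"
    and le: "\<And>h. 0 < h \<Longrightarrow> \<bar>\<rho> h\<bar> \<le> L_tilde f L0 L1 x (h *\<^sub>R u) * \<Phi> h"
    and \<rho>: "((\<lambda>h. \<rho> h / h ^ k) \<longlongrightarrow> T * q) (at_right 0)"
    and \<Phi>: "((\<lambda>h. \<Phi> h / h ^ k) \<longlongrightarrow> q) (at_right 0)"
  shows "\<bar>T\<bar> \<le> L0 + L1 * norm (gradient f x)"
proof -
  have "\<bar>T * q\<bar> \<le> (L0 + L1 * norm (gradient f x)) * q"
  proof (rule tendsto_le)
    show "((\<lambda>h. \<bar>\<rho> h / h ^ k\<bar>) \<longlongrightarrow> \<bar>T * q\<bar>) (at_right 0)"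
      using \<rho> by (rule tendsto_rabs)
    show "((\<lambda>h. L_tilde f L0 L1 x (h *\<^sub>R u) * (\<Phi> h / h ^ k)) \<longlongrightarrow>
        (L0 + L1 * norm (gradient f x)) * q) (at_right 0)"
      by (intro tendsto_mult L_tilde_tendsto \<Phi> \<open>0 \<le> L1\<close>)
    show "\<forall>\<^sub>F h in at_right 0. \<bar>\<rho> h / h ^ k\<bar> \<le> L_tilde f L0 L1 x (h *\<^sub>R u) * (\<Phi> h / h ^ k)"
      using eventually_at_right_less[of "0::real"]
      by eventually_elim (use le in \<open>simp add: divide_right_mono\<close>)
  qed simp
  then show ?thesis
    using \<open>0 < q\<close> by (simp add: abs_mult)
qed

section \<open>Symmetry of the third derivative\<close>

locale c3_function =
  fixes f :: "real ^ 'n \<Rightarrow> real"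
  assumes C3: "three_times_continuously_differentiable f"
begin

lemma has_derivative_f: "(f has_derivative (\<lambda>h. h \<bullet> gradient f x)) (at x)"
  using C3 by (intro has_derivative_gradient) (simp add: three_times_continuously_differentiable_def)

lemma has_derivative_gradient_f: "(gradient f has_derivative (\<lambda>h. hessian f x *v h)) (at x)"
  using C3 unfolding three_times_continuously_differentiable_def hessian_def
  by (simp flip: jacobian_works)

lemma has_derivative_hessian_f:
  "(hessian f has_derivative frechet_derivative (hessian f) (at x)) (at x)"
  using C3 by (simp add: three_times_continuously_differentiable_def frechet_derivative_works)

lemma has_derivative_hessian_apply:
  "((\<lambda>y. hessian f y *v v) has_derivative (\<lambda>h. frechet_derivative (hessian f) (at x) h *v v)) (at x)"
  using bounded_linear.has_derivative[OF bounded_linear_matrix_vector_mult_left has_derivative_hessian_f] .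

lemma has_derivative_hessian_entry:
  "((\<lambda>y. (hessian f y *v v) \<bullet> w) has_derivative (\<lambda>h. third_derivative f x h v w)) (at x)"
  unfolding third_derivative_def
  using bounded_linear.has_derivative[OF bounded_linear_inner_matrix_vector_mult has_derivative_hessian_f] .

lemma trilinear_third_derivative: "trilinear (third_derivative f x)"
proof -
  have "linear (\<lambda>u. third_derivative f x u v w)" for v w
    using has_derivative_linear[OF has_derivative_hessian_entry] .
  moreover have "linear (\<lambda>v. third_derivative f x u v w)" for u w
    by (rule linearI)
      (simp_all add: third_derivative_def matrix_vector_right_distrib inner_add_left
        matrix_vector_mult_scaleR)
  moreover have "linear (third_derivative f x u v)" for u v
    by (rule linearI) (simp_all add: third_derivative_def inner_add_right)
  ultimately show ?thesis
    by (simp add: trilinear_def)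
qed

lemma hessian_symmetric: "(hessian f x *v u) \<bullet> v = (hessian f x *v v) \<bullet> u"
  by (rule derivative_of_gradient_symmetric[OF has_derivative_f has_derivative_gradient_f])

text \<open>The Hessian is symmetric at every point, so the derivatives of its transposed entries agree.\<close>

lemma third_derivative_sym23: "third_derivative f x u v w = third_derivative f x u w v"
proof -
  have "(\<lambda>y. (hessian f y *v v) \<bullet> w) = (\<lambda>y. (hessian f y *v w) \<bullet> v)"
    by (rule ext) (rule hessian_symmetric)
  then have "((\<lambda>y. (hessian f y *v v) \<bullet> w) has_derivative (\<lambda>h. third_derivative f x h w v)) (at x)"
    using has_derivative_hessian_entry by simp
  from has_derivative_unique[OF has_derivative_hessian_entry this] show ?thesis
    by meson
qed

text \<open>The component \<open>gradient f y \<bullet> w\<close> has the gradient \<open>hessian f y *v w\<close> because the Hessian is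
  symmetric; the symmetry of its second derivative is the claim up to exchanging the last two arguments.\<close>

lemma third_derivative_sym12: "third_derivative f x u v w = third_derivative f x v u w"
proof -
  have "((\<lambda>y. gradient f y \<bullet> w) has_derivative (\<lambda>h. (hessian f y *v h) \<bullet> w)) (at y)" for y
    using bounded_linear.has_derivative[OF bounded_linear_inner_left has_derivative_gradient_f] .
  moreover have "(\<lambda>h. (hessian f y *v h) \<bullet> w) = (\<lambda>h. h \<bullet> (hessian f y *v w))" for y
    by (rule ext) (metis hessian_symmetric inner_commute)
  ultimately have "((\<lambda>y. gradient f y \<bullet> w) has_derivative (\<lambda>h. h \<bullet> (hessian f y *v w))) (at y)" for y
    by simp
  from derivative_of_gradient_symmetric[OF this has_derivative_hessian_apply]
  have "third_derivative f x u w v = third_derivative f x v w u"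
    unfolding third_derivative_def .
  then show ?thesis
    by (simp only: third_derivative_sym23[of x _ w])
qed

section \<open>Derivatives of the Taylor remainders along a segment\<close>

lemma hessian_along_line:
  "((\<lambda>t. (hessian f (x + t *\<^sub>R s) - hessian f x) *v v) has_vector_derivative
    frechet_derivative (hessian f) (at (x + t *\<^sub>R s)) s *v v) (at t)"
proof -
  have "((\<lambda>t. hessian f (x + t *\<^sub>R s) *v v - hessian f x *v v) has_vector_derivative
      frechet_derivative (hessian f) (at (x + t *\<^sub>R s)) s *v v - 0) (at t)"
    by (intro has_vector_derivative_diff has_vector_derivative_along_line
        has_derivative_hessian_apply has_vector_derivative_const)
  then show ?thesis
    by (simp add: matrix_vector_mult_diff_rdistrib)
qed

lemma gradient_along_line:
  "((\<lambda>t. gradient f (x + t *\<^sub>R s) - gradient f x - t *\<^sub>R (hessian f x *v s)) has_vector_derivative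
    (hessian f (x + t *\<^sub>R s) - hessian f x) *v s) (at t)"
proof -
  have "((\<lambda>t. gradient f (x + t *\<^sub>R s) - gradient f x - t *\<^sub>R (hessian f x *v s)) has_vector_derivative
      hessian f (x + t *\<^sub>R s) *v s - 0 - 1 *\<^sub>R (hessian f x *v s)) (at t)"
    by (intro has_vector_derivative_diff has_vector_derivative_along_line
        has_derivative_gradient_f has_vector_derivative_const)
      (auto intro!: derivative_eq_intros)
  then show ?thesis
    by (simp add: matrix_vector_mult_diff_rdistrib)
qed

lemma f_along_line:
  "((\<lambda>t. f (x + t *\<^sub>R s) - f x - t * (gradient f x \<bullet> s) - t\<^sup>2 / 2 * ((hessian f x *v s) \<bullet> s))
    has_real_derivative
    (gradient f (x + t *\<^sub>R s) - gradient f x - t *\<^sub>R (hessian f x *v s)) \<bullet> s) (at t)"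
proof -
  have "((\<lambda>t. f (x + t *\<^sub>R s)) has_real_derivative s \<bullet> gradient f (x + t *\<^sub>R s)) (at t)"
    unfolding has_real_derivative_iff_has_vector_derivative
    by (intro has_vector_derivative_along_line has_derivative_f)
  then show ?thesis
    by (auto intro!: derivative_eq_intros simp: inner_diff inner_commute)
qed

section \<open>From the third-derivative bound to the remainder bounds\<close>

text \<open>One integration per conclusion, each using the preceding one. The constant \<open>m\<close> is left free because
  the lemma serves twice: first with a provisional maximum, to establish the growth estimate, and then
  with \<open>L_tilde f L0 L1 x s\<close>. The Hessian is tested on vectors since the matrix type carries the
  Frobenius norm, while the bound concerns the operator norm.\<close>

lemma remainder_bounds:
  assumes third: "\<And>y. tensor_norm (third_derivative f y) \<le> L0 + L1 * norm (gradient f y)"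
    and growth: "\<And>t. 0 \<le> t \<Longrightarrow> t \<le> 1 \<Longrightarrow>
      L0 + L1 * norm (gradient f (x + t *\<^sub>R s)) \<le> m * cosh (a * t)"
    and t: "0 \<le> t" "t \<le> 1"
  shows "norm ((hessian f (x + t *\<^sub>R s) - hessian f x) *v v)
      \<le> m * norm s * norm v * (t * sinh_quot (a * t))"
    and "norm (gradient f (x + t *\<^sub>R s) - gradient f x - t *\<^sub>R (hessian f x *v s))
      \<le> m * norm s ^ 2 * (t\<^sup>2 * cosh_quot (a * t))"
    and "\<bar>f (x + t *\<^sub>R s) - f x - t * (gradient f x \<bullet> s) - t\<^sup>2 / 2 * ((hessian f x *v s) \<bullet> s)\<bar>
      \<le> m * norm s ^ 3 * (t ^ 3 * sinh_cubic_quot (a * t))"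
proof -
  have hess: "norm ((hessian f (x + t *\<^sub>R s) - hessian f x) *v v)
      \<le> m * norm s * norm v * (t * sinh_quot (a * t))" if t: "0 \<le> t" "t \<le> 1" for t v
  proof (rule norm_le_of_derivative_le[OF t(1) hessian_along_line])
    show "((\<lambda>\<tau>. m * norm s * norm v * (\<tau> * sinh_quot (a * \<tau>))) has_real_derivative
        m * norm s * norm v * cosh (a * \<tau>)) (at \<tau>)" for \<tau>
      by (intro DERIV_cmult has_derivative_sinh_quot)
    fix \<tau>
    assume "0 \<le> \<tau>" "\<tau> \<le> t"
    let ?y = "x + \<tau> *\<^sub>R s"
    let ?w = "frechet_derivative (hessian f) (at ?y) s *v v"
    \<comment> \<open>Testing the trilinear form on \<open>?w\<close> itself turns the bound on the form into a bound on the vector.\<close>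
    have "norm ?w * norm ?w = third_derivative f ?y s v ?w"
      by (simp add: third_derivative_def flip: power2_norm_eq_inner power2_eq_square)
    also have "\<dots> \<le> tensor_norm (third_derivative f ?y) * norm s * norm v * norm ?w"
      using trilinear_le_tensor_norm[OF trilinear_third_derivative] abs_le_D1 by blast
    finally have "norm ?w \<le> tensor_norm (third_derivative f ?y) * norm s * norm v"
      by (cases "?w = 0")
        (simp_all add: tensor_norm_nonneg[OF trilinear_third_derivative])
    also have "\<dots> \<le> m * cosh (a * \<tau>) * norm s * norm v"
      using third[of ?y] growth[of \<tau>] \<open>0 \<le> \<tau>\<close> \<open>\<tau> \<le> t\<close> t
      by (intro mult_right_mono) auto
    finally show "norm ?w \<le> m * norm s * norm v * cosh (a * \<tau>)"
      by (simp add: mult_ac)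
  qed simp_all
  show "norm ((hessian f (x + t *\<^sub>R s) - hessian f x) *v v)
      \<le> m * norm s * norm v * (t * sinh_quot (a * t))"
    using t by (rule hess)
  have grad: "norm (gradient f (x + t *\<^sub>R s) - gradient f x - t *\<^sub>R (hessian f x *v s))
      \<le> m * norm s ^ 2 * (t\<^sup>2 * cosh_quot (a * t))" if t: "0 \<le> t" "t \<le> 1" for t
  proof (rule norm_le_of_derivative_le[OF t(1) gradient_along_line])
    show "((\<lambda>\<tau>. m * norm s ^ 2 * (\<tau>\<^sup>2 * cosh_quot (a * \<tau>))) has_real_derivative
        m * norm s ^ 2 * (\<tau> * sinh_quot (a * \<tau>))) (at \<tau>)" for \<tau>
      by (intro DERIV_cmult has_derivative_cosh_quot)
    show "norm ((hessian f (x + \<tau> *\<^sub>R s) - hessian f x) *v s)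
        \<le> m * norm s ^ 2 * (\<tau> * sinh_quot (a * \<tau>))" if "0 \<le> \<tau>" "\<tau> \<le> t" for \<tau>
      using hess[of \<tau> s] that t by (simp add: power2_eq_square mult.assoc)
  qed simp_all
  show "norm (gradient f (x + t *\<^sub>R s) - gradient f x - t *\<^sub>R (hessian f x *v s))
      \<le> m * norm s ^ 2 * (t\<^sup>2 * cosh_quot (a * t))"
    using t by (rule grad)
  have "norm (f (x + t *\<^sub>R s) - f x - t * (gradient f x \<bullet> s) - t\<^sup>2 / 2 * ((hessian f x *v s) \<bullet> s))
      \<le> m * norm s ^ 3 * (t ^ 3 * sinh_cubic_quot (a * t))"
  proof (rule norm_le_of_derivative_le[OF t(1)
        f_along_line[unfolded has_real_derivative_iff_has_vector_derivative]])
    show "((\<lambda>\<tau>. m * norm s ^ 3 * (\<tau> ^ 3 * sinh_cubic_quot (a * \<tau>))) has_real_derivative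
        m * norm s ^ 3 * (\<tau>\<^sup>2 * cosh_quot (a * \<tau>))) (at \<tau>)" for \<tau>
      by (intro DERIV_cmult has_derivative_sinh_cubic_quot)
    fix \<tau>
    assume \<tau>: "0 \<le> \<tau>" "\<tau> \<le> t"
    let ?r = "gradient f (x + \<tau> *\<^sub>R s) - gradient f x - \<tau> *\<^sub>R (hessian f x *v s)"
    have "norm (?r \<bullet> s) \<le> norm ?r * norm s"
      by (simp add: Cauchy_Schwarz_ineq2)
    also have "\<dots> \<le> m * norm s ^ 2 * (\<tau>\<^sup>2 * cosh_quot (a * \<tau>)) * norm s"
      using \<tau> t by (intro mult_right_mono grad) auto
    finally show "norm (?r \<bullet> s) \<le> m * norm s ^ 3 * (\<tau>\<^sup>2 * cosh_quot (a * \<tau>))"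
      by (simp add: power2_eq_square power3_eq_cube mult_ac)
  qed simp_all
  then show "\<bar>f (x + t *\<^sub>R s) - f x - t * (gradient f x \<bullet> s) - t\<^sup>2 / 2 * ((hessian f x *v s) \<bullet> s)\<bar>
      \<le> m * norm s ^ 3 * (t ^ 3 * sinh_cubic_quot (a * t))"
    by simp
qed

text \<open>A Gronwall-type estimate, proved by evaluating the doubly integrated inequality at a point where
  \<open>\<psi>\<close> is maximal.\<close>

lemma gradient_growth:
  assumes "0 \<le> L1"
    and third: "\<And>y. tensor_norm (third_derivative f y) \<le> L0 + L1 * norm (gradient f y)"
    and t: "0 \<le> t" "t \<le> 1"
  shows "L0 + L1 * norm (gradient f (x + t *\<^sub>R s))
    \<le> L_tilde f L0 L1 x s * cosh (sqrt L1 * norm s * t)"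
proof -
  define a where "a = sqrt L1 * norm s"
  define L where "L = L_tilde f L0 L1 x s"
  define r where "r t = norm (gradient f (x + t *\<^sub>R s) - gradient f x - t *\<^sub>R (hessian f x *v s))" for t
  define \<psi> where "\<psi> t = (L + L1 * r t) / cosh (a * t)" for t
  have "continuous_on {0..1} r"
    unfolding r_def
    by (intro continuous_on_norm continuous_at_imp_continuous_on ballI
        has_vector_derivative_continuous[OF gradient_along_line])
  then have "continuous_on {0..1} \<psi>"
    unfolding \<psi>_def by (intro continuous_intros) auto
  then obtain t' where t': "t' \<in> {0..1}" and max: "\<And>t. t \<in> {0..1} \<Longrightarrow> \<psi> t \<le> \<psi> t'"
    using continuous_attains_sup[of "{0..1::real}" \<psi>] by auto
  define m where "m = \<psi> t'"
  have m: "L + L1 * r t \<le> m * cosh (a * t)" if "0 \<le> t" "t \<le> 1" for t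
    using max[of t] that by (simp add: m_def \<psi>_def[of t] pos_divide_le_eq cosh_real_pos)
  have growth: "L0 + L1 * norm (gradient f (x + t *\<^sub>R s)) \<le> L + L1 * r t" if "0 \<le> t" "t \<le> 1" for t
  proof -
    have "norm (gradient f (x + t *\<^sub>R s)) \<le> norm (gradient f x + t *\<^sub>R (hessian f x *v s)) + r t"
      using norm_triangle_ineq[of "gradient f x + t *\<^sub>R (hessian f x *v s)"
          "gradient f (x + t *\<^sub>R s) - gradient f x - t *\<^sub>R (hessian f x *v s)"]
      by (simp add: r_def)
    then have "L1 * norm (gradient f (x + t *\<^sub>R s))
        \<le> L1 * norm (gradient f x + t *\<^sub>R (hessian f x *v s)) + L1 * r t"
      using \<open>0 \<le> L1\<close> by (simp add: mult_left_mono flip: distrib_left)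
    then show ?thesis
      using segment_le_L_tilde[OF \<open>0 \<le> L1\<close> that, of L0 f x s] by (simp add: L_def)
  qed
  \<comment> \<open>Here \<open>m\<close> reproduces itself through \<open>cosh (a t) = 1 + a\<^sup>2 t\<^sup>2 cosh_quot (a t)\<close> with
    \<open>a\<^sup>2 = L1 * (norm s)\<^sup>2\<close>; the missing \<open>1\<close> is what forces \<open>m \<le> L\<close>.\<close>
  have "r t' \<le> m * norm s ^ 2 * (t'\<^sup>2 * cosh_quot (a * t'))"
    unfolding r_def using t' by (intro remainder_bounds(2)[OF third order_trans[OF growth m]]) auto
  then have "L1 * r t' \<le> L1 * (m * norm s ^ 2 * (t'\<^sup>2 * cosh_quot (a * t')))"
    using \<open>0 \<le> L1\<close> by (rule mult_left_mono)
  also have "\<dots> = m * (cosh (a * t') - 1)"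
    using \<open>0 \<le> L1\<close> by (simp add: cosh_eq_cosh_quot a_def power_mult_distrib)
  finally have "L1 * r t' \<le> m * cosh (a * t') - m"
    by (simp add: right_diff_distrib)
  moreover have "m * cosh (a * t') = L + L1 * r t'"
    by (simp add: m_def \<psi>_def)
  ultimately have "m \<le> L"
    by simp
  have "L0 + L1 * norm (gradient f (x + t *\<^sub>R s)) \<le> m * cosh (a * t)"
    using growth[OF t] m[OF t] by linarith
  also have "\<dots> \<le> L * cosh (a * t)"
    using \<open>m \<le> L\<close> by (intro mult_right_mono) auto
  finally show ?thesis
    by (simp add: L_def a_def)
qed

lemma bounds_of_third_derivative_bound:
  assumes "0 \<le> L1"
    and third: "\<And>y. tensor_norm (third_derivative f y) \<le> L0 + L1 * norm (gradient f y)"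
  shows "matrix_norm (hessian f (x + s) - hessian f x)
      \<le> L_tilde f L0 L1 x s * norm s * sinh_quot (sqrt L1 * norm s)"
    and "norm (gradient f (x + s) - gradient f x - hessian f x *v s)
      \<le> L_tilde f L0 L1 x s * norm s ^ 2 * cosh_quot (sqrt L1 * norm s)"
    and "\<bar>f (x + s) - f x - gradient f x \<bullet> s - 1 / 2 * ((hessian f x *v s) \<bullet> s)\<bar>
      \<le> L_tilde f L0 L1 x s * norm s ^ 3 * sinh_cubic_quot (sqrt L1 * norm s)"
  using remainder_bounds[OF third gradient_growth[OF assms], of 1 x s]
  by (auto intro!: matrix_norm_leI simp: mult_ac)

section \<open>From the remainder bounds to the third-derivative bound\<close>

lemma tendsto_hessian_remainder:
  "((\<lambda>h. ((hessian f (x + h *\<^sub>R u) - hessian f x) *v v) \<bullet> w / h) \<longlongrightarrow> third_derivative f x u v w) (at_right 0)"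
proof -
  have "((\<lambda>h. (hessian f (x + h *\<^sub>R u) *v v) \<bullet> w) has_real_derivative third_derivative f (x + 0 *\<^sub>R u) u v w) (at 0)"
    unfolding has_real_derivative_iff_has_vector_derivative
    by (intro has_vector_derivative_along_line has_derivative_hessian_entry)
  then show ?thesis
    by (simp add: DERIV_def matrix_vector_mult_diff_rdistrib inner_diff_left filterlim_at_split)
qed

lemma tendsto_gradient_remainder:
  "((\<lambda>h. (gradient f (x + h *\<^sub>R u) - gradient f x - h *\<^sub>R (hessian f x *v u)) \<bullet> w / h\<^sup>2)
    \<longlongrightarrow> third_derivative f x u u w / 2) (at_right 0)"
proof -
  have "((\<lambda>h. (gradient f (x + h *\<^sub>R u) - gradient f x - h *\<^sub>R (hessian f x *v u)) \<bullet> w)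
      has_real_derivative ((hessian f (x + h *\<^sub>R u) - hessian f x) *v u) \<bullet> w) (at h)" for h
    unfolding has_real_derivative_iff_has_vector_derivative
    by (rule bounded_linear.has_vector_derivative[OF bounded_linear_inner_left gradient_along_line])
  from tendsto_div_power_Suc[OF this, of 1] show ?thesis
    using tendsto_hessian_remainder[of x u u w] by (simp add: power2_eq_square)
qed

lemma tendsto_f_remainder:
  "((\<lambda>h. (f (x + h *\<^sub>R u) - f x - h * (gradient f x \<bullet> u) - h\<^sup>2 / 2 * ((hessian f x *v u) \<bullet> u)) / h ^ 3)
    \<longlongrightarrow> third_derivative f x u u u / 6) (at_right 0)"
  using tendsto_div_power_Suc[OF f_along_line[of x u] _ tendsto_gradient_remainder[of x u u]]
  by (simp add: numeral_3_eq_3 numeral_2_eq_2)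

lemma third_derivative_bound_of_hessian_bound:
  assumes "0 \<le> L1"
    and le: "\<And>s. matrix_norm (hessian f (x + s) - hessian f x)
      \<le> L_tilde f L0 L1 x s * norm s * sinh_quot (sqrt L1 * norm s)"
  shows "tensor_norm (third_derivative f x) \<le> L0 + L1 * norm (gradient f x)"
proof (rule tensor_norm_leI)
  fix u v w :: "real ^ 'n"
  assume unit: "norm u = 1" "norm v = 1" "norm w = 1"
  show "\<bar>third_derivative f x u v w\<bar> \<le> L0 + L1 * norm (gradient f x)"
  proof (rule abs_le_of_remainder_limits[OF \<open>0 \<le> L1\<close>, where k = 1 and q = 1])
    fix h :: real
    assume "0 < h"
    let ?A = "hessian f (x + h *\<^sub>R u) - hessian f x"
    have "\<bar>(?A *v v) \<bullet> w\<bar> \<le> matrix_norm ?A"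
      using Cauchy_Schwarz_ineq2[of "?A *v v" w] norm_matrix_vector_mult_le[of ?A v] unit by simp
    also have "\<dots> \<le> L_tilde f L0 L1 x (h *\<^sub>R u) * (h * sinh_quot (sqrt L1 * h))"
      using le[of "h *\<^sub>R u"] unit \<open>0 < h\<close> by (simp add: mult.assoc)
    finally show "\<bar>(?A *v v) \<bullet> w\<bar> \<le> \<dots>" .
  qed (use tendsto_hessian_remainder[of x u v w] tendsto_sinh_quot[of "sqrt L1"] in simp_all)
qed

text \<open>The limit yields the bound on \<open>T u u w\<close>; for fixed \<open>w\<close> this is the diagonal of a symmetric bilinear
  form.\<close>

lemma third_derivative_bound_of_gradient_bound:
  assumes "0 \<le> L1"
    and le: "\<And>s. norm (gradient f (x + s) - gradient f x - hessian f x *v s)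
      \<le> L_tilde f L0 L1 x s * norm s ^ 2 * cosh_quot (sqrt L1 * norm s)"
  shows "tensor_norm (third_derivative f x) \<le> L0 + L1 * norm (gradient f x)"
proof (rule tensor_norm_leI)
  have diag: "\<bar>third_derivative f x u u w\<bar> \<le> L0 + L1 * norm (gradient f x)"
    if unit: "norm u = 1" "norm w = 1" for u w
  proof (rule abs_le_of_remainder_limits[OF \<open>0 \<le> L1\<close> _ _ _ tendsto_cosh_quot])
    fix h :: real
    assume "0 < h"
    let ?r = "gradient f (x + h *\<^sub>R u) - gradient f x - h *\<^sub>R (hessian f x *v u)"
    have "\<bar>?r \<bullet> w\<bar> \<le> norm ?r"
      using Cauchy_Schwarz_ineq2[of ?r w] unit by simp
    also have "\<dots> \<le> L_tilde f L0 L1 x (h *\<^sub>R u) * (h\<^sup>2 * cosh_quot (sqrt L1 * h))"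
      using le[of "h *\<^sub>R u"] unit \<open>0 < h\<close> by (simp add: mult.assoc matrix_vector_mult_scaleR)
    finally show "\<bar>?r \<bullet> w\<bar> \<le> \<dots>" .
  qed (use tendsto_gradient_remainder[of x u w] in simp_all)
  show "\<bar>third_derivative f x u v w\<bar> \<le> L0 + L1 * norm (gradient f x)"
    if "norm u = 1" "norm v = 1" "norm w = 1" for u v w
    using symmetric_bilinear_le_of_diagonal_le[where B = "\<lambda>u v. third_derivative f x u v w",
        OF _ third_derivative_sym12] trilinear_third_derivative[of x] diag that
    by (auto simp: trilinear_def)
qed

lemma third_derivative_bound_of_function_bound:
  assumes "0 \<le> L1"
    and le: "\<And>s. \<bar>f (x + s) - f x - gradient f x \<bullet> s - 1 / 2 * ((hessian f x *v s) \<bullet> s)\<bar>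
      \<le> L_tilde f L0 L1 x s * norm s ^ 3 * sinh_cubic_quot (sqrt L1 * norm s)"
  shows "tensor_norm (third_derivative f x) \<le> L0 + L1 * norm (gradient f x)"
proof (rule tensor_norm_leI)
  have diag: "\<bar>third_derivative f x u u u\<bar> \<le> L0 + L1 * norm (gradient f x)"
    if unit: "norm u = 1" for u
  proof (rule abs_le_of_remainder_limits[OF \<open>0 \<le> L1\<close> _ _ _ tendsto_sinh_cubic_quot])
    fix h :: real
    assume "0 < h"
    let ?e = "f (x + h *\<^sub>R u) - f x - h * (gradient f x \<bullet> u) - h\<^sup>2 / 2 * ((hessian f x *v u) \<bullet> u)"
    show "\<bar>?e\<bar> \<le> L_tilde f L0 L1 x (h *\<^sub>R u) * (h ^ 3 * sinh_cubic_quot (sqrt L1 * h))"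
      using le[of "h *\<^sub>R u"] unit \<open>0 < h\<close>
      by (simp add: mult.assoc matrix_vector_mult_scaleR power2_eq_square)
  qed (use tendsto_f_remainder[of x u] in simp_all)
  show "\<bar>third_derivative f x u v w\<bar> \<le> L0 + L1 * norm (gradient f x)"
    if "norm u = 1" "norm v = 1" "norm w = 1" for u v w
    by (rule symmetric_trilinear_le_of_diagonal_le[OF trilinear_third_derivative
          third_derivative_sym12 third_derivative_sym23 diag that])
qed

end

theorem theorem1:
  fixes f :: "real ^ 'n \<Rightarrow> real" and L0 L1 :: real
  assumes "L0 \<ge> 0" and "L1 \<ge> 0"
    and "three_times_continuously_differentiable f"
  shows
    "((\<forall>x. tensor_norm (third_derivative f x) \<le> L0 + L1 * norm (gradient f x)) \<longleftrightarrow>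
      (\<forall>x s. matrix_norm (hessian f (x + s) - hessian f x)
        \<le> L_tilde f L0 L1 x s * norm s * sinh_quot (sqrt L1 * norm s))) \<and>
     ((\<forall>x. tensor_norm (third_derivative f x) \<le> L0 + L1 * norm (gradient f x)) \<longleftrightarrow>
      (\<forall>x s. norm (gradient f (x + s) - gradient f x - hessian f x *v s)
        \<le> L_tilde f L0 L1 x s * norm s ^ 2 * cosh_quot (sqrt L1 * norm s))) \<and>
     ((\<forall>x. tensor_norm (third_derivative f x) \<le> L0 + L1 * norm (gradient f x)) \<longleftrightarrow>
      (\<forall>x s. \<bar>f (x + s) - f x - gradient f x \<bullet> s - 1 / 2 * ((hessian f x *v s) \<bullet> s)\<bar>
        \<le> L_tilde f L0 L1 x s * norm s ^ 3 * sinh_cubic_quot (sqrt L1 * norm s)))"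
proof -
  interpret c3_function f
    using assms(3) by unfold_locales
  show ?thesis
    using bounds_of_third_derivative_bound[OF assms(2), of L0]
      third_derivative_bound_of_hessian_bound[OF assms(2), of _ L0]
      third_derivative_bound_of_gradient_bound[OF assms(2), of _ L0]
      third_derivative_bound_of_function_bound[OF assms(2), of _ L0]
    by blast
qed

end
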